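(* Let $L_0=2$, $L_1=1$, $L_{n+2}=L_{n+1}+L_n$ be the Lucas numbers and suppose the move costs are $w_{n,k}=\alpha_n=L_n$ for all $n\in\mathbb{N}_0$ and all $k\in T=\{0,1,2\}$. Let $t_n$ denote the common value $d_{n,0}=d_{n,1}=d_{n,2}$ of the minimal costs. Then for all $n\in\mathbb{N}_0$, $$t_n=3\cdot2^n-L_{n+2}.$$ Moreover, $(t_n)$ satisfies the order-$3$ recurrence $$t_0=0,\ t_1=2,\ t_2=5,\qquad t_{n+3}=3t_{n+2}-t_{n+1}-2t_n\quad(n\in\mathbb{N}_0).$$
   Context: Weighted Tower of Hanoi: $\mathbb{N}_0$ denotes the nonnegative integers; $T=\{0,1,2\}$ is the set of pegs; discs are labelled $1,2,3,\dots$ by increasing size. A state with $n$ discs is an assignment of the discs $1,\dots,n$ to the pegs, the discs on each peg being stacked with smaller discs above larger ones. A legal move transfers the topmost (smallest) disc of one peg to a different peg carrying no smaller disc. For $i\in T$, $i^n$ is the perfect state with all $n$ discs on peg $i$. For $\{i,j,k\}=T$ and $n\in\mathbb{N}_0$, $w_{n,k}\in[0,\infty)$ is a given cost of a single move of disc $n+1$ between pegs $i$ and $j$ (in either direction), and $d_{n,k}$ is the minimal total cost, over all finite sequences of legal moves, of getting from $i^n$ to $j^n$ with $n$ discs. When the costs do not depend on $k$, the values $d_{n,0},d_{n,1},d_{n,2}$ coincide. *)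

theory Defs
  imports Complex_Main "HOL-Library.FuncSet"
begin

definition pegs :: "nat set" where
  "pegs = {0, 1, 2}"

text \<open>
  A state is the map sending each disc to the peg it lies on; the stacking order is determined by
  the disc sizes. Extensionality makes states with the same discs on the same pegs equal; in
  particular all perfect states with 0 discs coincide.
\<close>

type_synonym state = "nat \<Rightarrow> nat"

definition states :: "nat \<Rightarrow> state set" where
  "states n = {1..n} \<rightarrow>\<^sub>E pegs"

definition perfect :: "nat \<Rightarrow> nat \<Rightarrow> state" where
  "perfect n i = (\<lambda>d\<in>{1..n}. i)"

text \<open>Disc \<open>d\<close> is the topmost one on its peg and moves to a different peg \<open>q\<close> without smaller discs.\<close>

definition legal_move :: "nat \<Rightarrow> state \<Rightarrow> nat \<Rightarrow> nat \<Rightarrow> bool" where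
  "legal_move n s d q \<longleftrightarrow>
     d \<in> {1..n} \<and> q \<in> pegs \<and> q \<noteq> s d \<and> (\<forall>e\<in>{1..<d}. s e \<noteq> s d \<and> s e \<noteq> q)"

definition third_peg :: "nat \<Rightarrow> nat \<Rightarrow> nat" where
  "third_peg i j = (THE k. {i, j, k} = pegs)"

text \<open>\<open>w n k\<close> is the cost of moving disc \<open>n + 1\<close> between the two pegs other than \<open>k\<close>.\<close>

definition move_cost :: "(nat \<Rightarrow> nat \<Rightarrow> real) \<Rightarrow> nat \<Rightarrow> nat \<Rightarrow> nat \<Rightarrow> real" where
  "move_cost w d p q = w (d - 1) (third_peg p q)"

text \<open>\<open>reach w n s s' c\<close>: some finite sequence of legal moves of total cost \<open>c\<close> leads from \<open>s\<close> to \<open>s'\<close>.\<close>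

inductive reach :: "(nat \<Rightarrow> nat \<Rightarrow> real) \<Rightarrow> nat \<Rightarrow> state \<Rightarrow> state \<Rightarrow> real \<Rightarrow> bool"
  for w :: "nat \<Rightarrow> nat \<Rightarrow> real" and n :: nat where
  stop: "s \<in> states n \<Longrightarrow> reach w n s s 0"
| move: "s \<in> states n \<Longrightarrow> legal_move n s d q \<Longrightarrow> reach w n (s(d := q)) s' c
           \<Longrightarrow> reach w n s s' (move_cost w d (s d) q + c)"

definition min_cost :: "(nat \<Rightarrow> nat \<Rightarrow> real) \<Rightarrow> nat \<Rightarrow> state \<Rightarrow> state \<Rightarrow> real" where
  "min_cost w n s s' = (LEAST c. reach w n s s' c)"

text \<open>
  The index \<open>k\<close> leaves open in which direction the tower is transferred between the other two pegs
  \<open>i\<close> and \<open>j\<close>; the definition takes the common value for both directions, which agree by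
  \<open>min_cost_sym\<close> below.
\<close>

definition tower_cost :: "(nat \<Rightarrow> nat \<Rightarrow> real) \<Rightarrow> nat \<Rightarrow> nat \<Rightarrow> real" where
  "tower_cost w n k =
     (THE c. \<forall>i j. {i, j, k} = pegs \<longrightarrow> c = min_cost w n (perfect n i) (perfect n j))"

fun lucas :: "nat \<Rightarrow> nat" where
  "lucas 0 = 2"
| "lucas (Suc 0) = 1"
| "lucas (Suc (Suc n)) = lucas (Suc n) + lucas n"

lemma three_pegs:
  "{i, j, k} = pegs \<longleftrightarrow>
     i \<in> pegs \<and> j \<in> pegs \<and> k \<in> pegs \<and> i \<noteq> j \<and> i \<noteq> k \<and> j \<noteq> k"
proof
  assume *: "{i, j, k} = pegs"
  then have "card {i, j, k} = 3"
    by (simp add: pegs_def)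
  then have "i \<noteq> j \<and> i \<noteq> k \<and> j \<noteq> k"
    by (auto simp: card_insert_if split: if_splits)
  with * show "i \<in> pegs \<and> j \<in> pegs \<and> k \<in> pegs \<and> i \<noteq> j \<and> i \<noteq> k \<and> j \<noteq> k"
    by blast
next
  assume "i \<in> pegs \<and> j \<in> pegs \<and> k \<in> pegs \<and> i \<noteq> j \<and> i \<noteq> k \<and> j \<noteq> k"
  then have "{i, j, k} \<subseteq> pegs" "card {i, j, k} = card pegs"
    by (simp_all add: pegs_def)
  then show "{i, j, k} = pegs"
    by (intro card_subset_eq) (simp_all add: pegs_def)
qed

lemma third_peg_eq: "{i, j, k} = pegs \<Longrightarrow> third_peg i j = k"
  unfolding third_peg_def three_pegs by (rule the_equality) (auto simp: pegs_def)

lemma third_peg_commute: "third_peg i j = third_peg j i"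
  by (simp add: third_peg_def insert_commute)

lemma reach_end: "reach w n s s' c \<Longrightarrow> s' \<in> states n"
  by (induction rule: reach.induct)

lemma reach_snoc:
  assumes "reach w n s s' c" "legal_move n s' d q" "s'(d := q) \<in> states n"
  shows "reach w n s (s'(d := q)) (c + move_cost w d (s' d) q)"
  using assms
proof (induction rule: reach.induct)
  case (stop s)
  then show ?case
    using reach.move[OF stop(1) stop(2) reach.stop[OF stop(3)]] by simp
next
  case (move s e p s' c)
  then show ?case
    using reach.move[OF move(1) move(2) move.IH] by (simp add: add.assoc)
qed

lemma reach_sym: "reach w n s s' c \<Longrightarrow> reach w n s' s c"
proof (induction rule: reach.induct)
  case (stop s)
  then show ?case by (rule reach.stop)
next
  case (move s d q s' c)
  have d: "d \<in> {1..n}"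
    using move(2) unfolding legal_move_def by blast
  have sd: "s d \<in> pegs"
    using PiE_mem[OF move(1)[unfolded states_def] d] .
  have *: "legal_move n (s(d := q)) d (s d)"
    using move(2) sd by (simp add: legal_move_def)
  have "(s(d := q))(d := s d) = s"
    by simp
  then have "reach w n s' s (c + move_cost w d q (s d))"
    using reach_snoc[OF move.IH *] move(1) by (simp only: fun_upd_same)
  moreover have "c + move_cost w d q (s d) = move_cost w d (s d) q + c"
    unfolding move_cost_def third_peg_commute[of q "s d"] by (rule add.commute)
  ultimately show ?case
    by (simp only:)
qed

lemma min_cost_sym: "min_cost w n s s' = min_cost w n s' s"
proof -
  have "reach w n s s' = reach w n s' s"
    by (intro ext iffI) (erule reach_sym)+
  then show ?thesis
    unfolding min_cost_def by (rule arg_cong)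
qed

lemma tower_cost_eq:
  assumes "{i, j, k} = pegs"
  shows "tower_cost w n k = min_cost w n (perfect n i) (perfect n j)"
  unfolding tower_cost_def
proof (rule the_equality)
  show "\<forall>i' j'. {i', j', k} = pegs \<longrightarrow>
      min_cost w n (perfect n i) (perfect n j) = min_cost w n (perfect n i') (perfect n j')"
  proof (intro allI impI)
    fix i' j'
    assume *: "{i', j', k} = pegs"
    have "{i', j'} = pegs - {k}"
      using * iffD1[OF three_pegs *] by blast
    moreover have "{i, j} = pegs - {k}"
      using assms iffD1[OF three_pegs assms] by blast
    ultimately consider "i' = i" "j' = j" | "i' = j" "j' = i"
      by (metis doubleton_eq_iff)
    then show "min_cost w n (perfect n i) (perfect n j) = min_cost w n (perfect n i') (perfect n j')"
      by cases (simp, simp add: min_cost_sym)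
  qed
next
  fix c
  assume *: "\<forall>i j. {i, j, k} = pegs \<longrightarrow> c = min_cost w n (perfect n i) (perfect n j)"
  show "c = min_cost w n (perfect n i) (perfect n j)"
    by (rule *[rule_format, OF assms])
qed

end

theory Submission
  imports Defs
begin

text \<open>
  If the cost \<open>a n\<close> of moving disc \<open>n + 1\<close> is nonnegative and independent of the pegs, the classical
  strategy is optimal: to transfer \<open>n + 1\<close> discs, clear the smaller ones onto the third peg, move
  the largest disc once, and bring the smaller ones back. Hence the minimal cost is the
  sequence \<open>transfer_cost a\<close> with \<open>T\<^sub>0 = 0\<close> and \<open>T (n + 1) = 2 T n + a n\<close>.

  To avoid dissecting a move sequence at the first and last move of its largest disc, optimality is
  certified by a potential. The function \<open>cost_to_perfect\<close> records what the classical strategy costs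
  when it starts from an arbitrary state and gathers all discs on a peg \<open>j\<close>. It drops by at most the
  cost of the move in each legal move (\<open>cost_to_perfect_legal_move\<close>) and vanishes at the target, so
  no move sequence costs less (\<open>cost_to_perfect_le_reach\<close>); since the strategy attains it
  (\<open>reach_perfect\<close>), it is the minimal cost. Starting from all discs on another peg it equals
  \<open>transfer_cost a n\<close>.

  For Lucas weights the recurrence solves to \<open>T n = 3 \<cdot> 2\<^sup>n - L (n + 2)\<close>, because the particular
  solution \<open>- L (n + 2)\<close> satisfies \<open>- L (n + 3) = - 2 L (n + 2) + L n\<close>. The characteristic roots of
  this closed form are \<open>2\<close> and the two roots of \<open>x\<^sup>2 - x - 1\<close>, and
  \<open>(x - 2) (x\<^sup>2 - x - 1) = x\<^sup>3 - 3 x\<^sup>2 + x + 2\<close> gives the recurrence of order 3.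
\<close>

section \<open>The cost of the classical strategy\<close>

fun transfer_cost :: "(nat \<Rightarrow> real) \<Rightarrow> nat \<Rightarrow> real" where
  "transfer_cost a 0 = 0"
| "transfer_cost a (Suc n) = 2 * transfer_cost a n + a n"

text \<open>
  If the largest disc is not yet on \<open>j\<close>, the smaller discs must first be gathered on the peg that
  is neither its own nor \<open>j\<close>, and afterwards transferred as a complete tower.
\<close>

fun cost_to_perfect :: "(nat \<Rightarrow> real) \<Rightarrow> nat \<Rightarrow> state \<Rightarrow> nat \<Rightarrow> real" where
  "cost_to_perfect a 0 s j = 0"
| "cost_to_perfect a (Suc n) s j =
     (if s (Suc n) = j then cost_to_perfect a n s j
      else cost_to_perfect a n s (third_peg (s (Suc n)) j) + a n + transfer_cost a n)"

lemma third_peg_pegs: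
  assumes "p \<in> pegs" "q \<in> pegs" "p \<noteq> q"
  shows "{p, q, third_peg p q} = pegs"
proof -
  have "card (pegs - {p, q}) = 1"
    using assms by (simp add: card_Diff_subset) (simp add: pegs_def)
  then obtain k where "pegs - {p, q} = {k}"
    by (auto simp: card_1_singleton_iff)
  then have "{p, q, k} = pegs"
    using assms by blast
  then show ?thesis
    using third_peg_eq by metis
qed

lemma cost_to_perfect_cong:
  assumes "\<And>e. e \<in> {1..n} \<Longrightarrow> s e = s' e"
  shows "cost_to_perfect a n s j = cost_to_perfect a n s' j"
  using assms by (induction n arbitrary: j) auto

lemma cost_to_perfect_tower:
  assumes "p \<in> pegs" "j \<in> pegs" "\<And>e. e \<in> {1..n} \<Longrightarrow> s e = p"
  shows "cost_to_perfect a n s j = (if p = j then 0 else transfer_cost a n)"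
  using assms
proof (induction n arbitrary: j)
  case (Suc n)
  show ?case
  proof (cases "p = j")
    case False
    have "third_peg p j \<in> pegs" "third_peg p j \<noteq> p"
      using third_peg_pegs[OF Suc.prems(1,2) False] unfolding three_pegs by auto
    then show ?thesis
      using Suc False by auto
  qed (use Suc in auto)
qed simp

section \<open>No move sequence is cheaper\<close>

text \<open>
  By recursion it suffices to consider a move of the largest disc, from \<open>p\<close> to \<open>q\<close>. All smaller
  discs then form a tower on the third peg \<open>r\<close>. If \<open>j\<close> is \<open>p\<close> or \<open>q\<close>, the potential changes by
  exactly \<open>a n\<close>. If \<open>j = r\<close>, the move is useless: before and after it, the tower on \<open>j\<close> has to be
  carried off and back again, at the same cost.
\<close>

lemma cost_to_perfect_legal_move:
  assumes "\<And>n. 0 \<le> a n"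
    and "\<And>e. e \<in> {1..n} \<Longrightarrow> s e \<in> pegs" "j \<in> pegs" "legal_move n s d q"
  shows "cost_to_perfect a n s j \<le> a (d - 1) + cost_to_perfect a n (s(d := q)) j"
  using assms(2-)
proof (induction n arbitrary: j)
  case 0
  then show ?case by (simp add: legal_move_def)
next
  case (Suc n)
  let ?p = "s (Suc n)"
  have p: "?p \<in> pegs" using Suc.prems(1) by simp
  define s' where "s' = s(d := q)"
  have "cost_to_perfect a (Suc n) s j \<le> a (d - 1) + cost_to_perfect a (Suc n) s' j"
  proof (cases "d = Suc n")
    case False
    then have lm: "legal_move n s d q"
      using Suc.prems(3) by (auto simp: legal_move_def)
    have IH: "cost_to_perfect a n s k \<le> a (d - 1) + cost_to_perfect a n s' k"
      if "k \<in> pegs" for k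
      unfolding s'_def by (rule Suc.IH[OF _ that lm]) (simp add: Suc.prems(1))
    have s': "s' (Suc n) = ?p" using False by (simp add: s'_def)
    show ?thesis
    proof (cases "?p = j")
      case True
      then show ?thesis using IH[OF Suc.prems(2)] s' by simp
    next
      case neq: False
      have "third_peg ?p j \<in> pegs"
        using third_peg_pegs[OF p Suc.prems(2) neq] unfolding three_pegs by auto
      from IH[OF this] show ?thesis using s' neq by simp
    qed
  next
    case d: True
    have q: "q \<in> pegs" "?p \<noteq> q" and free: "\<And>e. e \<in> {1..n} \<Longrightarrow> s e \<noteq> ?p \<and> s e \<noteq> q"
      using Suc.prems(3) d by (auto simp: legal_move_def)
    define r where "r = third_peg ?p q"
    have r: "{?p, q, r} = pegs"
      unfolding r_def using third_peg_pegs[OF p q] .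
    then have r': "r \<in> pegs" "r \<noteq> ?p" "r \<noteq> q" unfolding three_pegs by auto
    have "s e = r" if "e \<in> {1..n}" for e
      using that free[OF that] Suc.prems(1)[of e] r by auto
    then have tower: "cost_to_perfect a n s k = (if r = k then 0 else transfer_cost a n)"
      "cost_to_perfect a n s' k = (if r = k then 0 else transfer_cost a n)"
      if "k \<in> pegs" for k
      using cost_to_perfect_tower[OF r'(1) that, of n] d by (auto simp: s'_def)
    have s': "s' (Suc n) = q" by (simp add: s'_def d)
    consider "j = ?p" | "j = q" | "j = r" using r Suc.prems(2) by auto
    then show ?thesis
    proof cases
      case 1
      have "third_peg q ?p = r" unfolding r_def by (rule third_peg_commute)
      then show ?thesis using 1 d s' q p r' assms(1)[of n] by (simp add: tower)
    next
      case 2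
      then show ?thesis using d s' q r' by (simp add: tower flip: r_def)
    next
      case 3
      have "third_peg ?p r = q" "third_peg q r = ?p"
        using r by (auto intro!: third_peg_eq)
      then show ?thesis using 3 d s' q p r' assms(1)[of n] by (simp add: tower)
    qed
  qed
  then show ?case unfolding s'_def .
qed

lemma move_cost_uniform:
  assumes "\<And>n k. k \<in> pegs \<Longrightarrow> w n k = a n" "p \<in> pegs" "q \<in> pegs" "p \<noteq> q"
  shows "move_cost w d p q = a (d - 1)"
proof -
  have "third_peg p q \<in> pegs"
    using third_peg_pegs[OF assms(2-)] by auto
  then show ?thesis unfolding move_cost_def by (rule assms(1))
qed

lemma cost_to_perfect_le_reach:
  assumes "\<And>n k. k \<in> pegs \<Longrightarrow> w n k = a n" "\<And>n. 0 \<le> a n" "j \<in> pegs"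
    and "reach w n s s' c" "s' = perfect n j"
  shows "cost_to_perfect a n s j \<le> c"
  using assms(4,5)
proof (induction rule: reach.induct)
  case (stop s)
  then show ?case
    using cost_to_perfect_tower[of j j n s] assms(3) by (simp add: perfect_def)
next
  case (move s d q s' c)
  have pegs: "s e \<in> pegs" if "e \<in> {1..n}" for e
    using PiE_mem[OF move(1)[unfolded states_def] that] .
  have "d \<in> {1..n}" "q \<in> pegs" "s d \<noteq> q"
    using move(2) by (auto simp: legal_move_def)
  then have "move_cost w d (s d) q = a (d - 1)"
    by (intro move_cost_uniform assms(1) pegs)
  moreover have "cost_to_perfect a n s j \<le> a (d - 1) + cost_to_perfect a n (s(d := q)) j"
    by (rule cost_to_perfect_legal_move[OF assms(2) pegs assms(3) move(2)])
  ultimately show ?case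
    using move.IH[OF move.prems] by linarith
qed

section \<open>The classical strategy attains its cost\<close>

lemma reach_trans:
  assumes "reach w n s s' c" "reach w n s' s'' c'"
  shows "reach w n s s'' (c + c')"
  using assms
proof (induction rule: reach.induct)
  case (move s d q s' c)
  then show ?case
    using reach.move[OF move(1,2) move.IH] by (simp add: add.assoc)
qed simp

lemma states_Suc: "s \<in> states n \<Longrightarrow> p \<in> pegs \<Longrightarrow> s(Suc n := p) \<in> states (Suc n)"
  by (auto simp: states_def PiE_iff extensional_def)

lemma perfect_states: "j \<in> pegs \<Longrightarrow> perfect n j \<in> states n"
  by (auto simp: perfect_def states_def)

lemma perfect_Suc: "perfect (Suc n) j = (perfect n j)(Suc n := j)"
  by (auto simp: perfect_def)

text \<open>The largest disc never obstructs the smaller ones.\<close>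

lemma reach_add_largest_disc:
  assumes "reach w n s s' c" "p \<in> pegs"
  shows "reach w (Suc n) (s(Suc n := p)) (s'(Suc n := p)) c"
  using assms
proof (induction rule: reach.induct)
  case (stop s)
  then show ?case by (intro reach.stop states_Suc)
next
  case (move s d q s' c)
  have d: "d \<noteq> Suc n" using move(2) by (simp add: legal_move_def)
  have lm: "legal_move (Suc n) (s(Suc n := p)) d q"
    using move(2) by (auto simp: legal_move_def)
  have "reach w (Suc n) ((s(Suc n := p))(d := q)) (s'(Suc n := p)) c"
    using move.IH[OF move.prems] unfolding fun_upd_twist[OF d] .
  from reach.move[OF states_Suc[OF move(1) move.prems] lm this] show ?case
    unfolding fun_upd_other[OF d] .
qed

lemma reach_perfect:
  assumes w: "\<And>n k. k \<in> pegs \<Longrightarrow> w n k = a n" and "s \<in> states n" "j \<in> pegs"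
  shows "reach w n s (perfect n j) (cost_to_perfect a n s j)"
  using assms(2-)
proof (induction n arbitrary: s j)
  case 0
  then have "perfect 0 j = s" by (auto simp: perfect_def states_def)
  then show ?case using 0 by (simp add: reach.stop)
next
  case (Suc n)
  let ?p = "s (Suc n)"
  let ?s = "restrict s {1..n}"
  have p: "?p \<in> pegs" using Suc.prems(1) by (auto simp: states_def)
  have s: "?s \<in> states n"
    using Suc.prems(1) by (auto simp: states_def PiE_iff)
  have s_split: "?s(Suc n := ?p) = s"
    using Suc.prems(1) by (intro ext) (auto simp: states_def PiE_iff extensional_def)
  have gather: "reach w (Suc n) s ((perfect n k)(Suc n := ?p)) (cost_to_perfect a n s k)"
    if "k \<in> pegs" for k
  proof -
    have "cost_to_perfect a n ?s k = cost_to_perfect a n s k"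
      by (intro cost_to_perfect_cong) simp
    with reach_add_largest_disc[OF Suc.IH[OF s that] p] show ?thesis
      unfolding s_split by (simp only:)
  qed
  show ?case
  proof (cases "?p = j")
    case True
    then have "cost_to_perfect a (Suc n) s j = cost_to_perfect a n s j"
      by simp
    then show ?thesis
      using gather[OF Suc.prems(2)] True by (simp only: perfect_Suc)
  next
    case False
    define r where "r = third_peg ?p j"
    have r: "r \<in> pegs" "r \<noteq> ?p" "r \<noteq> j"
      using third_peg_pegs[OF p Suc.prems(2) False] unfolding three_pegs r_def by auto
    have tower: "cost_to_perfect a n (perfect n r) j = transfer_cost a n"
      using cost_to_perfect_tower[OF r(1) Suc.prems(2), of n "perfect n r"] r
      by (simp add: perfect_def)
    let ?u = "(perfect n r)(Suc n := ?p)"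
    have u: "?u(Suc n := j) = (perfect n r)(Suc n := j)" "?u (Suc n) = ?p"
      by simp_all
    have carry_back: "reach w (Suc n) (?u(Suc n := j)) (perfect (Suc n) j) (transfer_cost a n)"
      using reach_add_largest_disc[OF Suc.IH[OF perfect_states[OF r(1)] Suc.prems(2)] Suc.prems(2)]
      unfolding u tower perfect_Suc .
    have lm: "legal_move (Suc n) ?u (Suc n) j"
      using r False Suc.prems(2) by (auto simp: legal_move_def perfect_def)
    have "reach w (Suc n) ?u (perfect (Suc n) j)
        (move_cost w (Suc n) ?p j + transfer_cost a n)"
      using reach.move[OF states_Suc[OF perfect_states[OF r(1)] p] lm carry_back]
      unfolding u(2) .
    moreover have "move_cost w (Suc n) ?p j = a n"
      using move_cost_uniform[OF w p Suc.prems(2) False, where d = "Suc n"] by simp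
    ultimately have "reach w (Suc n) ?u (perfect (Suc n) j) (a n + transfer_cost a n)"
      by (simp only:)
    moreover have "cost_to_perfect a (Suc n) s j =
        cost_to_perfect a n s r + (a n + transfer_cost a n)"
      using False by (simp add: r_def)
    ultimately show ?thesis
      using reach_trans[OF gather[OF r(1)]] by (simp only:)
  qed
qed

theorem min_cost_perfect:
  assumes "\<And>n k. k \<in> pegs \<Longrightarrow> w n k = a n" "\<And>n. 0 \<le> a n" "s \<in> states n" "j \<in> pegs"
  shows "min_cost w n s (perfect n j) = cost_to_perfect a n s j"
  unfolding min_cost_def
proof (rule Least_equality)
  show "reach w n s (perfect n j) (cost_to_perfect a n s j)"
    using assms(1,3,4) by (rule reach_perfect)
next
  fix c
  assume "reach w n s (perfect n j) c"
  from cost_to_perfect_le_reach[OF assms(1,2,4) this refl]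
  show "cost_to_perfect a n s j \<le> c" .
qed

corollary tower_cost_uniform:
  assumes "\<And>n k. k \<in> pegs \<Longrightarrow> w n k = a n" "\<And>n. 0 \<le> a n" "k \<in> pegs"
  shows "tower_cost w n k = transfer_cost a n"
proof -
  obtain i where "i \<in> pegs" "i \<noteq> k"
    using that[of 0] that[of 1] by (auto simp: pegs_def)
  then obtain j where ij: "{i, j, k} = pegs"
    using third_peg_pegs[OF _ assms(3)] by (metis insert_commute)
  then have pegs: "i \<in> pegs" "j \<in> pegs" "i \<noteq> j" unfolding three_pegs by auto
  have "tower_cost w n k = cost_to_perfect a n (perfect n i) j"
    using tower_cost_eq[OF ij] min_cost_perfect[OF assms(1,2) perfect_states] pegs by simp
  also have "\<dots> = transfer_cost a n"
    using cost_to_perfect_tower[OF pegs(1,2), of n "perfect n i"] pegs(3)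
    by (simp add: perfect_def)
  finally show ?thesis .
qed

section \<open>Lucas weights\<close>

lemma transfer_cost_lucas:
  "transfer_cost (\<lambda>n. real (lucas n)) n = 3 * 2 ^ n - real (lucas (n + 2))"
  by (induction n) simp_all

theorem proposition8:
  fixes w :: "nat \<Rightarrow> nat \<Rightarrow> real" and t :: "nat \<Rightarrow> real"
  assumes w: "\<And>n k. k \<in> pegs \<Longrightarrow> w n k = real (lucas n)"
    and t: "\<And>n. t n = tower_cost w n 0"
  shows "(\<forall>n. \<forall>k\<in>pegs. tower_cost w n k = t n)
    \<and> (\<forall>n. t n = 3 * 2 ^ n - real (lucas (n + 2)))
    \<and> t 0 = 0 \<and> t 1 = 2 \<and> t 2 = 5
    \<and> (\<forall>n. t (n + 3) = 3 * t (n + 2) - t (n + 1) - 2 * t n)"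
proof -
  have cost: "tower_cost w n k = 3 * 2 ^ n - real (lucas (n + 2))" if "k \<in> pegs" for n k
    using tower_cost_uniform[OF w _ that] by (simp only: transfer_cost_lucas of_nat_0_le_iff)
  have t_closed: "t n = 3 * 2 ^ n - real (lucas (n + 2))" for n
    unfolding t by (rule cost) (simp add: pegs_def)
  have same: "tower_cost w n k = t n" if "k \<in> pegs" for n k
    unfolding t_closed by (rule cost[OF that])
  moreover have "t (n + 3) = 3 * t (n + 2) - t (n + 1) - 2 * t n" for n
    unfolding t_closed by (simp add: numeral_eq_Suc)
  moreover have "t 0 = 0" "t 1 = 2" "t 2 = 5"
    unfolding t_closed by (simp_all add: numeral_eq_Suc)
  ultimately show ?thesis
    using t_closed by blast
qed

end
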